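(* Let $n$ be a positive integer. For every $A\subseteq[2,n]$ with $\#A=\left\lfloor\frac{n-1}{2}\right\rfloor$ one has $\phi(A)=\psi(A)$; that is, $\phi=\psi$ as maps from $\binom{[2,n]}{\lfloor (n-1)/2\rfloor}$ to $\mathcal{A}_n$.
   Context: Notation: $[n]=\{1,\dots,n\}$, $[2,n]=\{2,\dots,n\}$; $\binom{X}{k}$ is the set of $k$-element subsets of $X$. $\mathfrak{S}_n$ is the set of permutations $\pi=\pi_1\ldots\pi_n$ of $[n]$ in one-line notation, $\operatorname{Pin}\pi=\{\pi_i \mid 2\le i\le n-1,\ \pi_{i-1}<\pi_i>\pi_{i+1}\}$, and $\mathcal{A}_n=\{S \mid S=\operatorname{Pin}\pi\text{ for some }\pi\in\mathfrak{S}_n\}$. Definition of $\psi$: for $A\in\binom{[2,n]}{\lfloor (n-1)/2\rfloor}$, let $\pi\in\mathfrak{S}_n$ be the interleaved permutation of $A$: fill the first $\lfloor (n-1)/2\rfloor$ even positions $2,4,\dots,2\lfloor (n-1)/2\rfloor$ with the elements of $A$ in increasing order from left to right, and fill the remaining positions with the elements of $[n]-A$ in increasing order from left to right. Put $\psi(A)=\operatorname{Pin}\pi$. Definition of $\phi$: associate with $A$ the lattice path $L=s_2s_3\ldots s_n$ starting at the origin, whose steps are indexed by $[2,n]$, where $s_i=D$ (the step $[1,-1]$) if $i\in A$ and $s_i=U$ (the step $[1,1]$) if $i\notin A$. Put $$\phi(A)=\{i \mid \text{in } L \text{ either } s_i=U \text{ lies strictly below the } x\text{-axis, or } s_i=D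 \text{ lies weakly above the } x\text{-axis}\}.$$ Here a step lies strictly below the $x$-axis if both of its endpoints have negative height, and weakly above the $x$-axis if both of its endpoints have nonnegative height. *)

theory Defs
  imports "HOL-Combinatorics.Permutations"
begin

(* A permutation pi_1 ... pi_n of {1..n} is a function pi with "pi permutes {1..n}";
   "pi i" is the entry in position i, counted from 1. *)

definition Pin :: "nat \<Rightarrow> (nat \<Rightarrow> nat) \<Rightarrow> nat set" where
  "Pin n \<pi> = {\<pi> i | i. 2 \<le> i \<and> i \<le> n - 1 \<and> \<pi> (i - 1) < \<pi> i \<and> \<pi> i > \<pi> (i + 1)}"

definition pinnacle_sets :: "nat \<Rightarrow> nat set set" where
  "pinnacle_sets n = {S. \<exists>\<pi>. \<pi> permutes {1..n} \<and> S = Pin n \<pi>}"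

definition even_positions :: "nat \<Rightarrow> nat set" where
  "even_positions n = {2 * k | k. 1 \<le> k \<and> k \<le> (n - 1) div 2}"

(* Writing the elements of X in increasing order, from left to right, into the positions P:
   position i receives the element of X whose (0-based) index is the number of
   positions of P to the left of i. *)
definition fill :: "nat set \<Rightarrow> nat set \<Rightarrow> nat \<Rightarrow> nat" where
  "fill P X i = sorted_list_of_set X ! card {j \<in> P. j < i}"

(* The identity outside {1..n}, as "permutes" requires. *)
definition interleaved :: "nat \<Rightarrow> nat set \<Rightarrow> nat \<Rightarrow> nat" where
  "interleaved n A i =
     (if i \<in> even_positions n then fill (even_positions n) A i
      else if i \<in> {1..n} then fill ({1..n} - even_positions n) ({1..n} - A) i
      else i)"

definition \<psi> :: "nat \<Rightarrow> nat set \<Rightarrow> nat set" where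
  "\<psi> n A = Pin n (interleaved n A)"

datatype step = U | D

fun rise :: "step \<Rightarrow> int" where
  "rise U = 1"
| "rise D = -1"

definition path_step :: "nat set \<Rightarrow> nat \<Rightarrow> step" where
  "path_step A i = (if i \<in> A then D else U)"

(* Steps are indexed from 2, so height A 1 = 0 is the origin, and step i leads from
   height A (i - 1) to height A i. *)
definition height :: "nat set \<Rightarrow> nat \<Rightarrow> int" where
  "height A i = (\<Sum>j = 2..i. rise (path_step A j))"

definition strictly_below :: "nat set \<Rightarrow> nat \<Rightarrow> bool" where
  "strictly_below A i \<longleftrightarrow> height A (i - 1) < 0 \<and> height A i < 0"

definition weakly_above :: "nat set \<Rightarrow> nat \<Rightarrow> bool" where
  "weakly_above A i \<longleftrightarrow> height A (i - 1) \<ge> 0 \<and> height A i \<ge> 0"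

definition \<phi> :: "nat \<Rightarrow> nat set \<Rightarrow> nat set" where
  "\<phi> n A = {i \<in> {2..n}. path_step A i = U \<and> strictly_below A i
                       \<or> path_step A i = D \<and> weakly_above A i}"

end

theory Submission
  imports Defs
begin

text \<open>
  Put m = (n - 1) div 2, let a(0) < ... < a(m - 1) be the elements of A and let
  b(0) < b(1) < ... be those of its complement B in [n], so that b(0) = 1. The interleaved
  permutation starts with b(0) a(0) b(1) a(1) ... a(m - 1) b(m). As both sequences increase,
  a(k) is a pinnacle iff b(k + 1) < a(k), and b(k) is one iff k < m and a(k) < b(k).
  The same two comparisons give the sign of the height of the path at the steps a(k) and b(k),
  because that height is determined by the numbers of elements of A and of B up to the step.
\<close>

section \<open>Ranks and increasing enumerations of finite sets of naturals\<close>

lemma rank_less_iff: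
  fixes X :: "nat set"
  assumes "finite X" "i \<in> X"
  shows "card {x \<in> X. x < i} < card {x \<in> X. x < j} \<longleftrightarrow> i < j"
proof
  assume "card {x \<in> X. x < i} < card {x \<in> X. x < j}"
  then show "i < j"
    using card_mono[of "{x \<in> X. x < i}" "{x \<in> X. x < j}"] assms(1)
    by (force simp: not_less[symmetric])
next
  assume "i < j"
  then show "card {x \<in> X. x < i} < card {x \<in> X. x < j}"
    using assms by (intro psubset_card_mono) auto
qed

lemma rank_less_card:
  fixes X :: "nat set"
  assumes "finite X" "i \<in> X"
  shows "card {x \<in> X. x < i} < card X"
  using assms by (intro psubset_card_mono) auto

lemma bij_betw_rank:
  fixes X :: "nat set"
  assumes "finite X"
  shows "bij_betw (\<lambda>i. card {x \<in> X. x < i}) X {..<card X}"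
proof -
  have inj: "inj_on (\<lambda>i. card {x \<in> X. x < i}) X"
  proof (rule inj_onI)
    fix i j assume "i \<in> X" "j \<in> X" "card {x \<in> X. x < i} = card {x \<in> X. x < j}"
    then show "i = j"
      using rank_less_iff[OF assms, of i j] rank_less_iff[OF assms, of j i] by simp
  qed
  \<comment> \<open>The image lies in \<open>{..<card X}\<close> and, by injectivity, has the same
    cardinality.\<close>
  have "(\<lambda>i. card {x \<in> X. x < i}) ` X = {..<card X}"
    by (intro card_subset_eq) (auto simp: card_image[OF inj] rank_less_card[OF assms])
  with inj show ?thesis by (simp add: bij_betw_def)
qed

lemma bij_betw_sorted_nth:
  fixes X :: "nat set"
  assumes "finite X"
  shows "bij_betw ((!) (sorted_list_of_set X)) {..<card X} X"
  using assms by (intro bij_betw_nth) auto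

lemma sorted_nth_strict_mono:
  fixes X :: "nat set"
  assumes "j < card X" "i < j"
  shows "sorted_list_of_set X ! i < sorted_list_of_set X ! j"
  using assms sorted_wrt_nth_less[OF strict_sorted_list_of_set[of X]] by simp

text \<open>The enumeration is strictly increasing, so the elements below entry \<open>k\<close> are
  exactly the images of the indices below \<open>k\<close>.\<close>

lemma rank_sorted_nth:
  fixes X :: "nat set"
  assumes "finite X" "k < card X"
  shows "card {x \<in> X. x < sorted_list_of_set X ! k} = k"
proof -
  let ?s = "(!) (sorted_list_of_set X)"
  note bij = bij_betw_sorted_nth[OF assms(1)]
  have less_iff: "?s i < ?s k \<longleftrightarrow> i < k" if "i < card X" for i
    using sorted_nth_strict_mono[of k X i] sorted_nth_strict_mono[of i X k] assms(2) that
    by (metis less_asym linorder_neqE_nat)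
  have "{x \<in> X. x < ?s k} = ?s ` {i \<in> {..<card X}. ?s i < ?s k}"
    using bij by (auto simp: bij_betw_def)
  also have "{i \<in> {..<card X}. ?s i < ?s k} = {..<k}"
    using less_iff assms(2) by auto
  finally have "{x \<in> X. x < ?s k} = ?s ` {..<k}" .
  moreover have "inj_on ?s {..<k}"
    using bij assms(2) by (auto simp: bij_betw_def intro: inj_on_subset)
  ultimately show ?thesis
    by (simp add: card_image)
qed

text \<open>Entry \<open>k\<close> has rank \<open>k\<close>, and rank reflects the order. The bound
  \<open>y\<close> need not lie in \<open>X\<close>: this turns comparisons between entries of
  \<open>A\<close> and of its complement into counts, the form in which path heights are
  available.\<close>

lemma sorted_nth_less_iff:
  fixes X :: "nat set"
  assumes "finite X" "k < card X"
  shows "sorted_list_of_set X ! k < y \<longleftrightarrow> k < card {x \<in> X. x < y}"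
proof -
  have "sorted_list_of_set X ! k \<in> X"
    using bij_betwE[OF bij_betw_sorted_nth[OF assms(1)]] assms(2) by auto
  from rank_less_iff[OF assms(1) this, of y] show ?thesis
    by (simp add: rank_sorted_nth[OF assms])
qed

lemma sorted_nth_cases:
  fixes X :: "nat set"
  assumes "finite X" "x \<in> X"
  obtains k where "k < card X" "x = sorted_list_of_set X ! k"
  using assms bij_betw_sorted_nth[OF assms(1)] unfolding bij_betw_def by blast

section \<open>Filling positions, and the entries of the interleaved permutation\<close>

lemma bij_betw_fill:
  assumes "finite P" "finite X" "card P = card X"
  shows "bij_betw (fill P X) P X"
  using bij_betw_trans[OF bij_betw_rank[OF assms(1)]] bij_betw_sorted_nth[OF assms(2)] assms(3)
  by (simp add: fill_def[abs_def] comp_def)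

lemma fill_strict_mono:
  assumes "finite P" "card P = card X" "i \<in> P" "j \<in> P" "i < j"
  shows "fill P X i < fill P X j"
  using assms rank_less_card[of P j] rank_less_iff[of P i j]
  by (simp add: fill_def sorted_nth_strict_mono)

lemma even_positions_iff:
  "i \<in> even_positions n \<longleftrightarrow> even i \<and> 2 \<le> i \<and> i \<le> 2 * ((n - 1) div 2)"
  by (auto simp: even_positions_def dvd_def)

lemma even_positions_eq: "even_positions n = (*) 2 ` {1..(n - 1) div 2}"
  by (auto simp: even_positions_def)

lemma card_even_positions: "card (even_positions n) = (n - 1) div 2"
  by (simp add: even_positions_eq card_image inj_on_def)

lemma even_positions_subset: "even_positions n \<subseteq> {1..n}"
  by (auto simp: even_positions_iff)

lemma card_remaining_positions:
  "card ({1..n} - even_positions n) = n - (n - 1) div 2"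
  using even_positions_subset[of n]
  by (simp add: card_Diff_subset finite_subset card_even_positions)

lemma card_even_positions_less:
  assumes "k < (n - 1) div 2"
  shows "card {j \<in> even_positions n. j < 2 * k + 2} = k"
proof -
  have "{j \<in> even_positions n. j < 2 * k + 2} = (*) 2 ` {1..k}"
    using assms by (auto simp: even_positions_eq)
  then show ?thesis by (simp add: card_image inj_on_def)
qed

text \<open>For even \<open>n\<close> the even position \<open>n\<close> also remains, but it lies
  to the right of \<open>2 * k + 1\<close>, so only the \<open>k\<close> smaller odd positions are
  counted.\<close>

lemma card_remaining_positions_less:
  assumes "k \<le> (n - 1) div 2" "n \<ge> 1"
  shows "card {j \<in> {1..n} - even_positions n. j < 2 * k + 1} = k"
proof -
  have "{j \<in> {1..n} - even_positions n. j < 2 * k + 1} = (\<lambda>i. 2 * i + 1) ` {..<k}"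
  proof (intro equalityI subsetI)
    fix j assume "j \<in> {j \<in> {1..n} - even_positions n. j < 2 * k + 1}"
    then have "odd j" "j < 2 * k + 1"
      using assms by (auto simp: even_positions_iff)
    then show "j \<in> (\<lambda>i. 2 * i + 1) ` {..<k}"
      by (auto elim!: oddE)
  qed (use assms in \<open>auto simp: even_positions_iff\<close>)
  then show ?thesis by (simp add: card_image inj_on_def)
qed

lemma interleaved_even:
  assumes "k < (n - 1) div 2"
  shows "interleaved n A (2 * k + 2) = sorted_list_of_set A ! k"
  using assms card_even_positions_less[OF assms]
  by (simp add: interleaved_def fill_def even_positions_iff)

lemma interleaved_odd:
  assumes "k \<le> (n - 1) div 2" "n \<ge> 1"
  shows "interleaved n A (2 * k + 1) = sorted_list_of_set ({1..n} - A) ! k"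
proof -
  have "2 * k + 1 \<le> n" using assms by linarith
  then have "2 * k + 1 \<in> {1..n}" "2 * k + 1 \<notin> even_positions n"
    by (auto simp: even_positions_iff)
  then show ?thesis
    by (simp only: interleaved_def fill_def card_remaining_positions_less[OF assms] if_True if_False)
qed

section \<open>Path heights as differences of counts\<close>

lemma height_eq_card_diff:
  assumes "A \<subseteq> {2..n}" "1 \<le> i" "i \<le> n"
  shows "height A i =
           int (card {x \<in> {1..n} - A. x \<le> i}) - 1 - int (card {x \<in> A. x \<le> i})"
  using assms(2,3)
proof (induction i rule: dec_induct)
  case base
  \<comment> \<open>The number 1 is counted in the complement although the path has no step with
    index 1; the \<open>- 1\<close> in the formula corrects for this.\<close>
  have "{x \<in> {1..n} - A. x \<le> 1} = {1}" "{x \<in> A. x \<le> 1} = {}"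
    using assms(1) base by auto
  then show ?case by (simp add: height_def)
next
  case (step i)
  have card_Suc: "card {x \<in> X. x \<le> Suc i} = card {x \<in> X. x \<le> i} + of_bool (Suc i \<in> X)" for X
  proof (cases "Suc i \<in> X")
    case True
    then have "{x \<in> X. x \<le> Suc i} = insert (Suc i) {x \<in> X. x \<le> i}" by (auto simp: le_Suc_eq)
    with True show ?thesis by simp
  next
    case False
    then have "{x \<in> X. x \<le> Suc i} = {x \<in> X. x \<le> i}" by (auto simp: le_Suc_eq)
    with False show ?thesis by simp
  qed
  have "height A (Suc i) = height A i + rise (path_step A (Suc i))"
    using step.hyps by (simp add: height_def)
  \<comment> \<open>Written with indicators, the rise is the increment of the complement count minus
    that of the count of \<open>A\<close>.\<close>
  also have "rise (path_step A (Suc i)) = of_bool (Suc i \<in> {1..n} - A) - of_bool (Suc i \<in> A)"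
    using step.prems by (simp add: path_step_def)
  finally show ?case
    using step.IH step.prems by (simp only: card_Suc of_nat_add of_nat_of_bool)
qed

section \<open>Comparison of the two maps on a fixed subset\<close>

locale path_subset =
  fixes n :: nat and A :: "nat set"
  assumes n: "n \<ge> 1"
    and A_subset: "A \<subseteq> {2..n}"
    and card_A_eq: "card A = (n - 1) div 2"
begin

definition m :: nat where "m = (n - 1) div 2"
definition B :: "nat set" where "B = {1..n} - A"
definition a :: "nat \<Rightarrow> nat" where "a = (!) (sorted_list_of_set A)"
definition b :: "nat \<Rightarrow> nat" where "b = (!) (sorted_list_of_set B)"

lemma A: "A \<subseteq> {2..n}" "card A = m"
  using A_subset card_A_eq by (simp_all add: m_def)

lemma finite_A: "finite A" and finite_B: "finite B"
  using A finite_subset by (auto simp: B_def)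

lemma card_B: "card B = n - m"
proof -
  have "A \<subseteq> {1..n}" using A by auto
  then show ?thesis
    using A finite_A by (simp add: B_def card_Diff_subset)
qed

lemma m_less_card_B: "m < card B"
  using n by (simp add: card_B m_def)

lemma a_strict_mono: "i < j \<Longrightarrow> j < m \<Longrightarrow> a i < a j"
  using A by (simp add: a_def sorted_nth_strict_mono)

lemma b_strict_mono: "i < j \<Longrightarrow> j \<le> m \<Longrightarrow> b i < b j"
  using m_less_card_B by (simp add: b_def sorted_nth_strict_mono)

lemma a_in: "k < m \<Longrightarrow> a k \<in> A"
  using bij_betwE[OF bij_betw_sorted_nth[OF finite_A]] A by (auto simp: a_def)

lemma b_in: "k < card B \<Longrightarrow> b k \<in> B"
  using bij_betwE[OF bij_betw_sorted_nth[OF finite_B]] by (auto simp: b_def)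

text \<open>Since \<open>A\<close> avoids 1, the least element of \<open>B\<close> is 1, which is
  not a step index; hence only \<open>b k\<close> with \<open>k \<ge> 1\<close> can be
  steps.\<close>

lemma b_0: "b 0 = 1"
proof -
  have "1 \<in> B" using A n by (auto simp: B_def)
  then obtain k where k: "k < card B" "1 = b k"
    using sorted_nth_cases[OF finite_B] unfolding b_def by metis
  have "k = card {x \<in> B. x < 1}"
    using rank_sorted_nth[OF finite_B k(1)] k(2) by (simp add: b_def)
  also have "{x \<in> B. x < 1} = {}" by (auto simp: B_def)
  finally have "k = 0" by simp
  with k show ?thesis by simp
qed

lemma interleaved_permutes: "interleaved n A permutes {1..n}"
proof -
  let ?E = "even_positions n" and ?O = "{1..n} - even_positions n"
  have "bij_betw (fill ?E A) ?E A"
    using finite_A A by (intro bij_betw_fill)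
      (auto simp: card_even_positions m_def intro: finite_subset[OF even_positions_subset])
  then have 1: "bij_betw (interleaved n A) ?E A"
    by (rule iffD1[OF bij_betw_cong, rotated]) (simp add: interleaved_def)
  have "bij_betw (fill ?O B) ?O B"
    using finite_B card_B card_remaining_positions[of n] by (intro bij_betw_fill) (auto simp: m_def)
  then have 2: "bij_betw (interleaved n A) ?O B"
    by (rule iffD1[OF bij_betw_cong, rotated]) (simp add: interleaved_def B_def)
  have "?E \<union> ?O = {1..n}" "A \<union> B = {1..n}" "A \<inter> B = {}"
    using even_positions_subset A by (auto simp: B_def)
  with bij_betw_combine[OF 1 2] have "bij_betw (interleaved n A) {1..n} {1..n}"
    by simp
  then show ?thesis
    using even_positions_subset[of n] by (intro bij_imp_permutes) (auto simp: interleaved_def)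
qed

text \<open>Monotonicity makes the comparison with one neighbour imply the other. The index
  \<open>k = 0\<close> is excluded because \<open>b 0\<close> is in position 1, and no element of
  \<open>B\<close> beyond \<open>b (m - 1)\<close> is a pinnacle because the word increases from
  \<open>b m\<close> on.\<close>

lemma psi_eq:
  "\<psi> n A = a ` {k. k < m \<and> b (k + 1) < a k} \<union> b ` {k. 1 \<le> k \<and> k < m \<and> a k < b k}"
    (is "_ = ?R")
proof -
  let ?p = "interleaved n A"
  have even: "?p (2 * k + 2) = a k" if "k < m" for k
    using interleaved_even that by (simp add: a_def m_def)
  have odd: "?p (2 * k + 1) = b k" if "k \<le> m" for k
    using interleaved_odd that n by (simp add: b_def B_def m_def)
  have n_le: "n \<le> 2 * m + 2" and n_ge: "2 * m + 1 \<le> n"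
    using n by (auto simp: m_def)
  show ?thesis
  proof (intro equalityI subsetI)
    fix x assume "x \<in> \<psi> n A"
    then obtain i where i: "x = ?p i" "2 \<le> i" "i \<le> n - 1" "?p (i - 1) < ?p i" "?p (i + 1) < ?p i"
      by (auto simp: \<psi>_def Pin_def)
    show "x \<in> ?R"
    proof (cases "even i")
      case True
      with i(2) obtain k where k: "i = 2 * k + 2"
        by (metis add.commute dvdE le_Suc_ex dvd_add_right_iff dvd_refl)
      \<comment> \<open>Here \<open>i \<le> n - 1 \<le> 2 * m + 1\<close>, so the even position
        \<open>i\<close> is one of those filled from \<open>A\<close>.\<close>
      then have "k < m" using i(3) n_le n_ge by linarith
      then show ?thesis
        using i even[of k] odd[of "k + 1"] k by (auto simp: numeral_eq_Suc)
    next
      case False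
      then obtain k where k: "i = 2 * k + 1" by (auto elim: oddE)
      have "1 \<le> k" "k \<le> m" using k i(2,3) n_le by linarith+
      \<comment> \<open>Position \<open>2 * m + 1\<close> is interior only if
        \<open>n = 2 * m + 2\<close>; then the last two positions are both filled from
        \<open>B\<close>, in increasing order, so there is no descent.\<close>
      moreover have "k \<noteq> m"
      proof
        assume "k = m"
        then have "n = 2 * m + 2" using n_le i(3) k n by linarith
        then have "i \<in> {1..n} - even_positions n" "i + 1 \<in> {1..n} - even_positions n"
          using k \<open>k = m\<close> by (auto simp: even_positions_iff m_def)
        then have "?p i < ?p (i + 1)"
          using fill_strict_mono[of "{1..n} - even_positions n" B i "i + 1"]
            card_B card_remaining_positions[of n]
          by (simp add: interleaved_def m_def B_def)
        with i(5) show False by simp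
      qed
      ultimately show ?thesis
        using i even[of k] odd[of k] k by auto
    qed
  next
    fix x assume "x \<in> ?R"
    then consider (A) k where "x = a k" "k < m" "b (k + 1) < a k"
      | (B) k where "x = b k" "1 \<le> k" "k < m" "a k < b k"
      by auto
    then show "x \<in> \<psi> n A"
    proof cases
      case A
      have "b k < a k" using b_strict_mono[of k "k + 1"] A by simp
      then have "x = ?p (2 * k + 2)" "?p (2 * k + 2 - 1) < ?p (2 * k + 2)"
          "?p (2 * k + 2 + 1) < ?p (2 * k + 2)"
        using A even[of k] odd[of k] odd[of "k + 1"] by (simp_all add: numeral_eq_Suc)
      moreover have "2 \<le> 2 * k + 2" "2 * k + 2 \<le> n - 1" using A n_ge by linarith+
      ultimately show ?thesis unfolding \<psi>_def Pin_def by blast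
    next
      case B
      \<comment> \<open>The left neighbour of \<open>b k\<close> is \<open>a (k - 1)\<close>, which
        is below \<open>a k\<close> and hence below \<open>b k\<close>.\<close>
      have "a (k - 1) < b k" using a_strict_mono[of "k - 1" k] B by simp
      moreover have "2 * k + 1 - 1 = 2 * (k - 1) + 2" using B by simp
      ultimately have "x = ?p (2 * k + 1)" "?p (2 * k + 1 - 1) < ?p (2 * k + 1)"
          "?p (2 * k + 1 + 1) < ?p (2 * k + 1)"
        using B even[of "k - 1"] even[of k] odd[of k] by simp_all
      moreover have "2 \<le> 2 * k + 1" "2 * k + 1 \<le> n - 1" using B n_ge by linarith+
      ultimately show ?thesis unfolding \<psi>_def Pin_def by blast
    qed
  qed
qed

text \<open>A down-step ends at its lower endpoint, so only the height there matters. Exactly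
  \<open>k + 1\<close> elements of \<open>A\<close> are at most \<open>a k\<close>, so this height
  is nonnegative iff at least \<open>k + 2\<close> elements of \<open>B\<close> precede
  \<open>a k\<close>, that is, iff \<open>b (k + 1)\<close> does.\<close>

lemma a_in_phi_iff:
  assumes "k < m"
  shows "a k \<in> \<phi> n A \<longleftrightarrow> b (k + 1) < a k"
proof -
  have in_A: "a k \<in> A" and notin_B: "a k \<notin> B" and bounds: "2 \<le> a k" "a k \<le> n"
    using a_in[OF assms] A by (auto simp: B_def)
  have "height A (a k) \<ge> 0 \<longleftrightarrow> k + 1 < card {x \<in> B. x < a k}"
  proof -
    have "{x \<in> A. x \<le> a k} = insert (a k) {x \<in> A. x < a k}" using in_A by auto
    moreover have "card {x \<in> A. x < a k} = k"
      using rank_sorted_nth finite_A A assms by (simp add: a_def)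
    ultimately have "card {x \<in> A. x \<le> a k} = k + 1" using finite_A by simp
    moreover have "{x \<in> B. x \<le> a k} = {x \<in> B. x < a k}" using notin_B by (auto simp: le_less)
    ultimately have "height A (a k) = int (card {x \<in> B. x < a k}) - 1 - int (k + 1)"
      using height_eq_card_diff[OF A(1), of "a k", folded B_def] bounds by (simp only:)
    then show ?thesis by linarith
  qed
  also have "\<dots> \<longleftrightarrow> b (k + 1) < a k"
    unfolding b_def using sorted_nth_less_iff[OF finite_B] assms m_less_card_B by simp
  finally have "height A (a k) \<ge> 0 \<longleftrightarrow> b (k + 1) < a k" .
  moreover have "height A (a k - 1) = height A (a k) + 1"
    using bounds in_A by (cases "a k") (auto simp: height_def path_step_def)
  ultimately show ?thesis
    using in_A bounds by (auto simp: \<phi>_def path_step_def weakly_above_def)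
qed

lemma b_in_phi_iff:
  assumes "1 \<le> k" "k < card B"
  shows "b k \<in> \<phi> n A \<longleftrightarrow> k < m \<and> a k < b k"
proof -
  have in_B: "b k \<in> B" and notin_A: "b k \<notin> A" and "b k \<le> n"
    using b_in[OF assms(2)] by (auto simp: B_def)
  have "b 0 < b k" using assms by (simp add: b_def sorted_nth_strict_mono)
  then have "2 \<le> b k" by (simp add: b_0)
  have "height A (b k) < 0 \<longleftrightarrow> k < card {x \<in> A. x < b k}"
  proof -
    have "{x \<in> B. x \<le> b k} = insert (b k) {x \<in> B. x < b k}" using in_B by auto
    moreover have "card {x \<in> B. x < b k} = k"
      using rank_sorted_nth finite_B assms by (simp add: b_def)
    ultimately have "card {x \<in> B. x \<le> b k} = k + 1" using finite_B by simp
    moreover have "{x \<in> A. x \<le> b k} = {x \<in> A. x < b k}" using notin_A by (auto simp: le_less)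
    ultimately have "height A (b k) = int (k + 1) - 1 - int (card {x \<in> A. x < b k})"
      using height_eq_card_diff[OF A(1), of "b k", folded B_def] \<open>2 \<le> b k\<close> \<open>b k \<le> n\<close>
      by (simp only:)
    then show ?thesis by linarith
  qed
  \<comment> \<open>The count is at most \<open>m\<close>, so exceeding \<open>k\<close> forces
    \<open>k < m\<close>; only then is \<open>a k\<close> an actual entry of the list.\<close>
  also have "\<dots> \<longleftrightarrow> k < m \<and> a k < b k"
    using sorted_nth_less_iff[OF finite_A, of k "b k"] A
      card_mono[OF finite_A, of "{x \<in> A. x < b k}"]
    by (auto simp: a_def)
  finally have "height A (b k) < 0 \<longleftrightarrow> k < m \<and> a k < b k" .
  moreover have "height A (b k - 1) = height A (b k) - 1"
    using \<open>2 \<le> b k\<close> notin_A by (cases "b k") (auto simp: height_def path_step_def)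
  ultimately show ?thesis
    using notin_A \<open>2 \<le> b k\<close> \<open>b k \<le> n\<close> by (auto simp: \<phi>_def path_step_def strictly_below_def)
qed

text \<open>Every step index is some \<open>a k\<close> or some \<open>b k\<close> with
  \<open>k \<ge> 1\<close>, so the two membership criteria describe the whole set, in the same form
  as for \<open>\<psi>\<close>.\<close>

lemma phi_eq:
  "\<phi> n A = a ` {k. k < m \<and> b (k + 1) < a k} \<union> b ` {k. 1 \<le> k \<and> k < m \<and> a k < b k}"
    (is "_ = ?R")
proof (intro equalityI subsetI)
  fix x assume x: "x \<in> \<phi> n A"
  then have "2 \<le> x" "x \<le> n" by (auto simp: \<phi>_def)
  show "x \<in> ?R"
  proof (cases "x \<in> A")
    case True
    then obtain k where "k < m" "x = a k"
      using sorted_nth_cases[OF finite_A] A unfolding a_def by metis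
    with x a_in_phi_iff show ?thesis by auto
  next
    case False
    then have "x \<in> B" using \<open>2 \<le> x\<close> \<open>x \<le> n\<close> by (simp add: B_def)
    then obtain k where k: "k < card B" "x = b k"
      using sorted_nth_cases[OF finite_B] unfolding b_def by metis
    have "k \<noteq> 0" using \<open>2 \<le> x\<close> k b_0 by (intro notI) simp
    with x k b_in_phi_iff[of k] show ?thesis by auto
  qed
next
  fix x assume "x \<in> ?R"
  then show "x \<in> \<phi> n A"
    using a_in_phi_iff b_in_phi_iff m_less_card_B by auto
qed

end

theorem proposition2p3:
  fixes n :: nat
  assumes "n \<ge> 1"
  shows "\<forall>A. A \<subseteq> {2..n} \<and> card A = (n - 1) div 2 \<longrightarrow>
           \<phi> n A = \<psi> n A \<and> \<phi> n A \<in> pinnacle_sets n \<and> \<psi> n A \<in> pinnacle_sets n"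
proof (intro allI impI)
  fix A assume A: "A \<subseteq> {2..n} \<and> card A = (n - 1) div 2"
  then interpret path_subset n A
    using assms by unfold_locales auto
  have "\<psi> n A \<in> pinnacle_sets n"
    using interleaved_permutes unfolding pinnacle_sets_def \<psi>_def by blast
  then show "\<phi> n A = \<psi> n A \<and> \<phi> n A \<in> pinnacle_sets n \<and> \<psi> n A \<in> pinnacle_sets n"
    by (simp add: phi_eq psi_eq)
qed

end
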